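(* Let $\gamma>0$, let $A_1,\ldots,A_N\in\mathbb{R}^{n\times n}$, $B_1,\ldots,B_N\in\mathbb{R}^{n\times m}$, let $Q\in\mathbb{R}^{n\times n}$ and $R\in\mathbb{R}^{m\times m}$ be symmetric positive definite, and let $\mathcal{M}=\{(A_1,B_1),\ldots,(A_N,B_N)\}$. Suppose there exist $K_1,\ldots,K_N\in\mathbb{R}^{m\times n}$ and symmetric matrices $P_{ij}\in\mathbb{R}^{n\times n}$ ($i,j\in\{1,\ldots,N\}$) with $0\prec P_{ij}=P_{ji}\prec\gamma^2I$ such that $$|x|_{P_{jk}}^2\ \ge\ |x|_Q^2+|K_kx|_R^2+\left|\tfrac12(A_i-B_iK_k+A_j-B_jK_k)x\right|^2_{(P_{ij}^{-1}-\gamma^{-2}I)^{-1}}-\gamma^2\left|\tfrac12(A_i-B_iK_k-A_j+B_jK_k)x\right|^2$$ for all $x\in\mathbb{R}^n$ and all $i,j,k\in\{1,\ldots,N\}$ except those with $i\ne j=k$. Then the Bellman inequality $\mathcal{F}\bar V\le\bar V$ (pointwise on $\mathbb{R}^n\times\mathbb{S}$) holds for $$\bar V(x,Z):=\max_{i,j\in\{1,\ldots,N\}}\left\{|x|_{P_{ij}}^2-\frac{\gamma^2}{2}\left\|\begin{bmatrix}I&A_i&B_i\end{bmatrix}^\top\right\|_Z^2-\frac{\gamma^2}{2}\left\|\begin{bmatrix}I&A_j&B_j\end{bmatrix}^\top\right\|_Z^2\right\},$$ and the bound $J_\mu(x_0)\le\max_{i,j}|x_0|_{P_{ij}}^2$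 holds for every $x_0\in\mathbb{R}^n$ for the control law $\mu$ defined by $$u_t=-K_{k_t}x_t,\qquad k_t=\arg\min_{i\in\{1,\ldots,N\}}\sum_{\tau=0}^{t-1}|A_ix_\tau+B_iu_\tau-x_{\tau+1}|^2$$ (with $k_t$ any minimizing index in case of ties).
   Context: Notation: for symmetric matrices, $\succ$, $\succeq$ denote the positive definite / semidefinite order. For a vector $x$ and symmetric $M$, $|x|_M^2:=x^\top Mx$, and $|x|$ is the Euclidean norm. For a matrix $C$ and symmetric $M$ of compatible size, $\|C\|_M^2:=\operatorname{trace}(C^\top MC)$. $\mathbb{S}$ denotes the set of symmetric positive semidefinite matrices in $\mathbb{R}^{(2n+m)\times(2n+m)}$. Cost of a control law: a control law $\mu=(\mu_t)_{t\ge0}$ is a sequence of functions giving $u_t=\mu_t(x_0,\ldots,x_t,u_0,\ldots,u_{t-1})\in\mathbb{R}^m$. For $x_0\in\mathbb{R}^n$, $$J_\mu(x_0):=\sup\ \sum_{t=0}^{h}\left(|x_t|_Q^2+|u_t|_R^2-\gamma^2|w_t|^2\right),$$ where the supremum is over all $(A,B)\in\mathcal{M}$, all integers $h\ge0$ and all sequences $w_t\in\mathbb{R}^n$, and $x,u$ are generated by $x_{t+1}=Ax_t+Bu_t+w_t$ for $t\ge0$ together with the control law $\mu$. Bellman operator: for a function $V$ on $\mathbb{R}^n\times\mathbb{S}$, $$\mathcal{F}V(x,Z):=\min_{u\in\mathbb{R}^m}\max_{v\in\mathbb{R}^n}\left\{|x|_Q^2+|u|_R^2+V\left(v,Z+\begin{bmatrix}-v\\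 x\\ u\end{bmatrix}\begin{bmatrix}-v\\ x\\ u\end{bmatrix}^\top\right)\right\},$$ where max and min are understood as supremum and infimum (possibly $+\infty$) when not known to be attained. *)

theory Defs
  imports "HOL-Analysis.Analysis"
begin

definition wnorm2 :: "real^'a^'a \<Rightarrow> real^'a \<Rightarrow> real"
  where "wnorm2 M x = x \<bullet> (M *v x)"

definition wfrob2 :: "real^'a^'a \<Rightarrow> real^'b^'a \<Rightarrow> real"
  where "wfrob2 M C = trace (transpose C ** M ** C)"

definition pos_def :: "real^'a^'a \<Rightarrow> bool"
  where "pos_def M \<longleftrightarrow> transpose M = M \<and> (\<forall>x. x \<noteq> 0 \<longrightarrow> wnorm2 M x > 0)"

definition pos_semidef :: "real^'a^'a \<Rightarrow> bool"
  where "pos_semidef M \<longleftrightarrow> transpose M = M \<and> (\<forall>x. wnorm2 M x \<ge> 0)"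

text \<open>\<open>\<real>\<^sup>2\<^sup>n\<^sup>+\<^sup>m\<close> is the space of vectors indexed by \<open>'n + 'n + 'm\<close>, with the three blocks in this order.\<close>

definition stack3 :: "real^'n \<Rightarrow> real^'n \<Rightarrow> real^'m \<Rightarrow> real^('n + 'n + 'm)"
  where "stack3 a b c =
    (\<chi> i. case i of Inl p \<Rightarrow> a $ p | Inr (Inl p) \<Rightarrow> b $ p | Inr (Inr q) \<Rightarrow> c $ q)"

text \<open>The block matrix \<open>[I A B]\<close>.\<close>

definition block_row :: "real^'n^'n \<Rightarrow> real^'m^'n \<Rightarrow> real^('n + 'n + 'm)^'n"
  where "block_row A B = (\<chi> r. stack3 (mat 1 $ r) (A $ r) (B $ r))"

definition outer :: "real^'a \<Rightarrow> real^'a^'a"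
  where "outer z = (\<chi> i j. z $ i * z $ j)"

text \<open>Minimum and maximum are taken as infimum and supremum in the extended reals. If \<open>Z\<close> is positive
  semidefinite, then \<open>V\<close> is only evaluated at positive semidefinite matrices, so its values elsewhere
  are irrelevant.\<close>

definition bellman ::
  "real^'n^'n \<Rightarrow> real^'m^'m
    \<Rightarrow> (real^'n \<Rightarrow> real^('n + 'n + 'm)^('n + 'n + 'm) \<Rightarrow> ereal)
    \<Rightarrow> real^'n \<Rightarrow> real^('n + 'n + 'm)^('n + 'n + 'm) \<Rightarrow> ereal"
  where "bellman Q R V x Z =
    (INF u. SUP v. ereal (wnorm2 Q x + wnorm2 R u) + V v (Z + outer (stack3 (- v) x u)))"

text \<open>A control law maps the time \<open>t\<close>, the state history \<open>[x\<^sub>0, \<dots>, x\<^sub>t]\<close> and the input history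
  \<open>[u\<^sub>0, \<dots>, u\<^sub>t\<^sub>-\<^sub>1]\<close> to the input \<open>u\<^sub>t\<close>; its values on lists of other lengths are irrelevant.\<close>

type_synonym ('n, 'm) control_law =
  "nat \<Rightarrow> (real^'n) list \<Rightarrow> (real^'m) list \<Rightarrow> real^'m"

definition trajectory ::
  "real^'n^'n \<Rightarrow> real^'m^'n \<Rightarrow> ('n, 'm) control_law \<Rightarrow> (nat \<Rightarrow> real^'n) \<Rightarrow> real^'n
    \<Rightarrow> (nat \<Rightarrow> real^'n) \<Rightarrow> (nat \<Rightarrow> real^'m) \<Rightarrow> bool"
  where "trajectory A B \<mu> w x0 x u \<longleftrightarrow>
    x 0 = x0 \<and>
    (\<forall>t. u t = \<mu> t (map x [0..<Suc t]) (map u [0..<t])) \<and>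
    (\<forall>t. x (Suc t) = A *v x t + B *v u t + w t)"

definition cost ::
  "((real^'n^'n) \<times> (real^'m^'n)) set \<Rightarrow> real \<Rightarrow> real^'n^'n \<Rightarrow> real^'m^'m
    \<Rightarrow> ('n, 'm) control_law \<Rightarrow> real^'n \<Rightarrow> ereal"
  where "cost \<M> \<gamma> Q R \<mu> x0 =
    Sup {ereal (\<Sum>t\<le>h. wnorm2 Q (x t) + wnorm2 R (u t) - \<gamma>\<^sup>2 * (norm (w t))\<^sup>2) | A B h w x u.
           (A, B) \<in> \<M> \<and> trajectory A B \<mu> w x0 x u}"

definition Vbar ::
  "nat \<Rightarrow> real \<Rightarrow> (nat \<Rightarrow> real^'n^'n) \<Rightarrow> (nat \<Rightarrow> real^'m^'n) \<Rightarrow> (nat \<Rightarrow> nat \<Rightarrow> real^'n^'n)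
    \<Rightarrow> real^'n \<Rightarrow> real^('n + 'n + 'm)^('n + 'n + 'm) \<Rightarrow> real"
  where "Vbar N \<gamma> A B P x Z =
    (MAX (i, j) \<in> {1..N} \<times> {1..N}.
       wnorm2 (P i j) x
       - \<gamma>\<^sup>2 / 2 * wfrob2 Z (transpose (block_row (A i) (B i)))
       - \<gamma>\<^sup>2 / 2 * wfrob2 Z (transpose (block_row (A j) (B j))))"

text \<open>A selection function \<open>k\<close> picks, for every history, some minimizing model index; ties may be
  broken in any way, also depending on time and history.\<close>

definition least_squares_selection ::
  "nat \<Rightarrow> (nat \<Rightarrow> real^'n^'n) \<Rightarrow> (nat \<Rightarrow> real^'m^'n)
    \<Rightarrow> (nat \<Rightarrow> (real^'n) list \<Rightarrow> (real^'m) list \<Rightarrow> nat) \<Rightarrow> bool"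
  where "least_squares_selection N A B k \<longleftrightarrow>
    (\<forall>t xs us. length xs = Suc t \<longrightarrow> length us = t \<longrightarrow>
       is_arg_min
         (\<lambda>i. \<Sum>\<tau><t. (norm (A i *v (xs ! \<tau>) + B i *v (us ! \<tau>) - xs ! Suc \<tau>))\<^sup>2)
         (\<lambda>i. i \<in> {1..N}) (k t xs us))"

definition selected_feedback ::
  "(nat \<Rightarrow> real^'n^'m) \<Rightarrow> (nat \<Rightarrow> (real^'n) list \<Rightarrow> (real^'m) list \<Rightarrow> nat) \<Rightarrow> ('n, 'm) control_law"
  where "selected_feedback K k = (\<lambda>t xs us. - (K (k t xs us) *v (xs ! t)))"

end

theory Submission
  imports Defs
begin

text \<open>Let \<open>c i\<close> be the accumulated squared prediction error of model \<open>i\<close>. The value function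
  depends on \<open>Z\<close> only through these errors, and one step with next state \<open>v\<close> adds \<open>|A\<^sub>i x + B\<^sub>i u - v|\<^sup>2\<close>
  to \<open>c i\<close>. For fixed \<open>(i, j)\<close> the average of the two added terms is, by the parallelogram law, the
  square of the distance of \<open>v\<close> from the mean prediction plus a term independent of \<open>v\<close>, so completing
  the square eliminates \<open>v\<close> and leaves the right side of the matrix inequality. If \<open>k\<close> minimizes \<open>c\<close>, then
  \<open>c i\<close> may be replaced by \<open>c k\<close>, which gives the Bellman inequality; the excluded triples
  \<open>i \<noteq> j = k\<close> are covered by exchanging \<open>i\<close> and \<open>j\<close>. The cost bound follows by telescoping, since the
  error of the true model is exactly the accumulated disturbance energy.\<close>

section \<open>Quadratic forms, inverses and completion of the square\<close>

lemma wnorm2_scaleR_mat_1_diff: "wnorm2 (c *\<^sub>R mat 1 - P) x = c * (norm x)\<^sup>2 - wnorm2 P x"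
  by (simp add: wnorm2_def matrix_vector_mult_diff_rdistrib scaleR_matrix_vector_assoc[symmetric]
      inner_diff_right power2_norm_eq_inner)

lemma pos_def_invertible:
  assumes "pos_def M"
  shows "invertible M"
proof -
  have "x = 0" if "M *v x = 0" for x
    using assms that unfolding pos_def_def wnorm2_def by (metis inner_zero_right less_irrefl)
  then show ?thesis
    by (simp add: invertible_left_inverse matrix_left_invertible_ker)
qed

lemma symmetric_inner_swap:
  fixes P :: "real^'n^'n"
  assumes "transpose P = P"
  shows "x \<bullet> (P *v y) = y \<bullet> (P *v x)"
  by (metis assms dot_lmul_matrix inner_commute transpose_matrix_vector)

lemma
  fixes M :: "real^'n^'n"
  assumes "invertible M"
  shows matrix_inv_right: "M ** matrix_inv M = mat 1"
    and matrix_inv_left: "matrix_inv M ** M = mat 1"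
  using someI_ex[OF assms[unfolded invertible_def]] by (simp_all add: matrix_inv_def)

lemma matrix_inv_mult_vec:
  fixes M :: "real^'n^'n"
  assumes "invertible M" "M *v x = y"
  shows "matrix_inv M *v y = x"
  using assms by (metis matrix_inv_left matrix_vector_mul_assoc matrix_vector_mul_lid)

text \<open>The left side is a concave quadratic in \<open>v\<close>, its Hessian being negative
  definite by \<open>D\<close>. Its stationary point \<open>q\<close> solves
  \<open>(\<gamma>\<^sup>2 *\<^sub>R mat 1 - P) *v q = \<gamma>\<^sup>2 *\<^sub>R a\<close>, and the
  value there is the right side.\<close>

lemma wnorm2_minus_dist_le:
  fixes P :: "real^'n^'n"
  assumes P: "pos_def P" and D: "pos_def (\<gamma>\<^sup>2 *\<^sub>R mat 1 - P)" and \<gamma>: "\<gamma> > 0"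
  shows "wnorm2 P v - \<gamma>\<^sup>2 * (norm (v - a))\<^sup>2
    \<le> wnorm2 (matrix_inv (matrix_inv P - (1 / \<gamma>\<^sup>2) *\<^sub>R mat 1)) a"
proof -
  define D where "D = \<gamma>\<^sup>2 *\<^sub>R mat 1 - P"
  define T where "T = matrix_inv P - (1 / \<gamma>\<^sup>2) *\<^sub>R mat 1"
  note P_inv = pos_def_invertible[OF P]
  have D_inv: "invertible D"
    using D pos_def_invertible D_def by blast
  have D_mult: "D *v x = \<gamma>\<^sup>2 *\<^sub>R x - P *v x" for x
    by (simp add: D_def matrix_vector_mult_diff_rdistrib scaleR_matrix_vector_assoc[symmetric])
  \<comment> \<open>Up to a positive factor, \<open>T ** P\<close> is \<open>D\<close>. Hence
    \<open>T\<close> inherits invertibility from \<open>D\<close> and \<open>P\<close>, and its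
    inverse at \<open>a\<close> can be read off from \<open>q\<close>.\<close>
  have TP: "T *v (P *v x) = (1 / \<gamma>\<^sup>2) *\<^sub>R (D *v x)" for x
    using \<gamma> matrix_inv_mult_vec[OF P_inv refl, of x]
    by (simp add: T_def D_mult matrix_vector_mult_diff_rdistrib
        scaleR_matrix_vector_assoc[symmetric] scaleR_diff_right)
  have "y = 0" if "T *v y = 0" for y
  proof -
    have y: "y = P *v (matrix_inv P *v y)"
      by (simp add: matrix_vector_mul_assoc matrix_inv_right[OF P_inv])
    then have "D *v (matrix_inv P *v y) = 0"
      using that TP[of "matrix_inv P *v y"] \<gamma> by simp
    then have "matrix_inv P *v y = 0"
      using D_inv matrix_inv_mult_vec by fastforce
    then show ?thesis
      using y by simp
  qed
  then have T_inv: "invertible T"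
    by (simp add: invertible_left_inverse matrix_left_invertible_ker)
  define q where "q = matrix_inv D *v (\<gamma>\<^sup>2 *\<^sub>R a)" \<comment> \<open>the maximizer of the left side over \<open>v\<close>\<close>
  have Dq: "D *v q = \<gamma>\<^sup>2 *\<^sub>R a"
    by (simp add: q_def matrix_vector_mul_assoc matrix_inv_right[OF D_inv])
  then have "T *v (P *v q) = a"
    using TP \<gamma> by simp
  then have Ta: "matrix_inv T *v a = P *v q"
    by (rule matrix_inv_mult_vec[OF T_inv])
  define p where "p = P *v q"
  have aq: "a = q - (1 / \<gamma>\<^sup>2) *\<^sub>R p"
  proof -
    have "a = (1 / \<gamma>\<^sup>2) *\<^sub>R (\<gamma>\<^sup>2 *\<^sub>R a)"
      using \<gamma> by simp
    also have "\<dots> = q - (1 / \<gamma>\<^sup>2) *\<^sub>R p"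
      unfolding Dq[symmetric] D_mult p_def using \<gamma> by (simp add: scaleR_diff_right)
    finally show ?thesis .
  qed
  define d where "d = v - q"
  have sym: "q \<bullet> (P *v d) = d \<bullet> p"
    unfolding p_def using P by (intro symmetric_inner_swap) (simp add: pos_def_def)
  have v: "v = q + d"
    by (simp add: d_def)
  have wv: "wnorm2 P v = q \<bullet> p + 2 * (d \<bullet> p) + wnorm2 P d"
    by (simp add: v wnorm2_def matrix_vector_right_distrib inner_add_left inner_add_right sym
        p_def[symmetric])
  have "v - a = d + (1 / \<gamma>\<^sup>2) *\<^sub>R p"
    by (simp add: v aq)
  then have "(norm (v - a))\<^sup>2 = (norm d)\<^sup>2 + 2 * (d \<bullet> p) / \<gamma>\<^sup>2 + (p \<bullet> p) / (\<gamma>\<^sup>2)\<^sup>2"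
    by (simp add: power2_norm_eq_inner inner_add_left inner_add_right inner_commute[of p d]
        power2_eq_square[of "\<gamma>\<^sup>2"] add_divide_distrib)
  then have nva: "\<gamma>\<^sup>2 * (norm (v - a))\<^sup>2 = \<gamma>\<^sup>2 * (norm d)\<^sup>2 + 2 * (d \<bullet> p) + (p \<bullet> p) / \<gamma>\<^sup>2"
    using \<gamma> by (simp add: field_simps power2_eq_square)
  have "wnorm2 P d \<le> \<gamma>\<^sup>2 * (norm d)\<^sup>2"
    using D wnorm2_scaleR_mat_1_diff[of "\<gamma>\<^sup>2" P d]
    by (cases "d = 0") (auto simp: pos_def_def wnorm2_def less_imp_le)
  \<comment> \<open>Stationarity of \<open>q\<close> makes the cross terms
    \<open>2 * (d \<bullet> p)\<close> of \<open>wv\<close> and \<open>nva\<close> cancel. What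
    remains in \<open>d\<close> is nonpositive.\<close>
  then have "wnorm2 P v - \<gamma>\<^sup>2 * (norm (v - a))\<^sup>2 \<le> q \<bullet> p - (p \<bullet> p) / \<gamma>\<^sup>2"
    unfolding wv nva by simp
  also have "\<dots> = wnorm2 (matrix_inv T) a"
    unfolding wnorm2_def Ta p_def[symmetric] by (simp add: aq inner_diff_left)
  finally show ?thesis
    unfolding T_def .
qed

text \<open>The parallelogram law for \<open>a - v\<close> and \<open>b - v\<close>. It confines
  \<open>v\<close> to a single square, to which \<open>wnorm2_minus_dist_le\<close> applies.\<close>

lemma mean_square_dist:
  fixes a b v :: "'a::real_inner"
  shows "((norm (a - v))\<^sup>2 + (norm (b - v))\<^sup>2) / 2
    = (norm (v - (1 / 2) *\<^sub>R (a + b)))\<^sup>2 + (norm ((1 / 2) *\<^sub>R (a - b)))\<^sup>2"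
  unfolding power2_norm_eq_inner
  by (simp add: inner_simps inner_commute algebra_simps) (simp add: field_simps)

section \<open>Prediction errors as rank-one updates of \<open>Z\<close>\<close>

lemma matrix_mult_add_rdistrib:
  fixes X Y :: "real^'b^'a"
  shows "(X + Y) ** M = X ** M + Y ** M"
  by (simp add: vec_eq_iff matrix_matrix_mult_def distrib_right sum.distrib)

lemma wfrob2_add_outer:
  fixes C :: "real^'b^'a"
  shows "wfrob2 (Z + outer z) C = wfrob2 Z C + (norm (transpose C *v z))\<^sup>2"
proof -
  have "transpose C ** outer z ** C = outer (transpose C *v z)"
    by (simp add: vec_eq_iff outer_def matrix_matrix_mult_def matrix_vector_mult_def transpose_def
        sum_distrib_left sum_distrib_right mult_ac)
  moreover have "trace (outer y) = (norm y)\<^sup>2" for y :: "real^'b"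
    by (simp add: trace_def outer_def power2_norm_eq_inner inner_vec_def)
  ultimately show ?thesis
    by (simp add: wfrob2_def matrix_add_ldistrib matrix_mult_add_rdistrib trace_add)
qed

lemma block_row_mult_stack3: "block_row A B *v stack3 (- v) x u = A *v x + B *v u - v"
proof -
  have "(\<Sum>j\<in>UNIV. mat 1 $ i $ j * v $ j) = v $ i" for i
    using matrix_vector_mul_lid[of v] by (simp add: matrix_vector_mult_def vec_eq_iff)
  then show ?thesis
    by (simp add: vec_eq_iff block_row_def stack3_def matrix_vector_mult_def UNIV_Plus_UNIV[symmetric]
        sum.Plus sum_negf del: UNIV_Plus_UNIV)
qed

text \<open>Keeping the errors \<open>c\<close> abstract lets one estimate serve twice:
  \<open>c\<close> is a weighted Frobenius norm in the Bellman inequality and a sum of squared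
  prediction errors in the cost bound.\<close>

definition model_value ::
  "nat \<Rightarrow> real \<Rightarrow> (nat \<Rightarrow> nat \<Rightarrow> real^'n^'n) \<Rightarrow> (nat \<Rightarrow> real) \<Rightarrow> real^'n \<Rightarrow> real"
  where "model_value N \<gamma> P c x =
    (MAX (i, j) \<in> {1..N} \<times> {1..N}. wnorm2 (P i j) x - \<gamma>\<^sup>2 / 2 * c i - \<gamma>\<^sup>2 / 2 * c j)"

lemma Vbar_eq_model_value:
  "Vbar N \<gamma> A B P x Z = model_value N \<gamma> P (\<lambda>i. wfrob2 Z (transpose (block_row (A i) (B i)))) x"
  unfolding Vbar_def model_value_def ..

lemma Vbar_add_outer:
  "Vbar N \<gamma> A B P v (Z + outer (stack3 (- v) x u)) =
    model_value N \<gamma> P (\<lambda>i. wfrob2 Z (transpose (block_row (A i) (B i)))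
      + (norm (A i *v x + B i *v u - v))\<^sup>2) v"
  by (simp add: Vbar_eq_model_value wfrob2_add_outer block_row_mult_stack3)

section \<open>One-step decrease of the value function\<close>

lemma model_value_ge:
  assumes "i \<in> {1..N}" "j \<in> {1..N}"
  shows "wnorm2 (P i j) x - \<gamma>\<^sup>2 / 2 * c i - \<gamma>\<^sup>2 / 2 * c j \<le> model_value N \<gamma> P c x"
  unfolding model_value_def using assms by (intro Max_ge) (auto intro!: rev_image_eqI[of "(i, j)"])

lemma model_value_le:
  assumes "N \<ge> 1"
    and "\<And>i j. i \<in> {1..N} \<Longrightarrow> j \<in> {1..N} \<Longrightarrow>
      wnorm2 (P i j) x - \<gamma>\<^sup>2 / 2 * c i - \<gamma>\<^sup>2 / 2 * c j \<le> b"
  shows "model_value N \<gamma> P c x \<le> b"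
  unfolding model_value_def using assms by (intro Max.boundedI) auto

text \<open>The pair \<open>(i, j)\<close> after the step is compared with the pair
  \<open>(j, k)\<close> before it. As \<open>v\<close> is arbitrary, this covers both the worst case
  in the Bellman operator and the actual next state of a trajectory.\<close>

lemma model_value_step:
  fixes A :: "nat \<Rightarrow> real^'n^'n"
    and B :: "nat \<Rightarrow> real^'m^'n"
    and K :: "nat \<Rightarrow> real^'n^'m"
  assumes N: "N \<ge> 1" and \<gamma>: "\<gamma> > 0"
    and P: "\<And>i j. i \<in> {1..N} \<Longrightarrow> j \<in> {1..N} \<Longrightarrow>
      pos_def (P i j) \<and> P i j = P j i \<and> pos_def (\<gamma>\<^sup>2 *\<^sub>R mat 1 - P i j)"
    and ineq: "\<And>x i j k. i \<in> {1..N} \<Longrightarrow> j \<in> {1..N} \<Longrightarrow> k \<in> {1..N} \<Longrightarrow> \<not> (i \<noteq> j \<and> j = k) \<Longrightarrow>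
      wnorm2 (P j k) x \<ge>
        wnorm2 Q x + wnorm2 R (K k *v x)
        + wnorm2 (matrix_inv (matrix_inv (P i j) - (1 / \<gamma>\<^sup>2) *\<^sub>R mat 1))
            (((1 / 2) *\<^sub>R (A i - B i ** K k + A j - B j ** K k)) *v x)
        - \<gamma>\<^sup>2 * (norm (((1 / 2) *\<^sub>R (A i - B i ** K k - A j + B j ** K k)) *v x))\<^sup>2"
    and k: "is_arg_min c (\<lambda>i. i \<in> {1..N}) k"
    and u: "u = - (K k *v x)"
  shows "wnorm2 Q x + wnorm2 R u
      + model_value N \<gamma> P (\<lambda>i. c i + (norm (A i *v x + B i *v u - v))\<^sup>2) v
    \<le> model_value N \<gamma> P c x"
proof -
  have k_mem: "k \<in> {1..N}" and k_min: "\<And>i. i \<in> {1..N} \<Longrightarrow> c k \<le> c i"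
    using k by (auto simp: is_arg_min_linorder)
  have Ru: "wnorm2 R u = wnorm2 R (K k *v x)"
    unfolding u wnorm2_def by (simp add: vec.neg)
  define a where "a i = A i *v x + B i *v u" for i
  let ?F = "\<lambda>i j. wnorm2 (P i j) v - \<gamma>\<^sup>2 / 2 * (c i + (norm (a i - v))\<^sup>2)
      - \<gamma>\<^sup>2 / 2 * (c j + (norm (a j - v))\<^sup>2)"
  have bound: "wnorm2 Q x + wnorm2 R u + ?F i j \<le> model_value N \<gamma> P c x"
    if i: "i \<in> {1..N}" and j: "j \<in> {1..N}" and ne: "\<not> (i \<noteq> j \<and> j = k)" for i j
  proof -
    \<comment> \<open>With this input, the closed-loop matrix of model \<open>i\<close> sends
      \<open>x\<close> to the prediction \<open>a i\<close>.\<close>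
    have s: "((1 / 2) *\<^sub>R (A i - B i ** K k + A j - B j ** K k)) *v x = (1 / 2) *\<^sub>R (a i + a j)"
      and d: "((1 / 2) *\<^sub>R (A i - B i ** K k - A j + B j ** K k)) *v x = (1 / 2) *\<^sub>R (a i - a j)"
      by (simp_all add: a_def u scaleR_matrix_vector_assoc[symmetric] matrix_vector_mult_diff_rdistrib
          matrix_vector_mult_add_rdistrib matrix_vector_mul_assoc[symmetric] vec.neg algebra_simps)
    have "wnorm2 (P i j) v - \<gamma>\<^sup>2 * (norm (v - (1 / 2) *\<^sub>R (a i + a j)))\<^sup>2
      \<le> wnorm2 (matrix_inv (matrix_inv (P i j) - (1 / \<gamma>\<^sup>2) *\<^sub>R mat 1)) ((1 / 2) *\<^sub>R (a i + a j))"
      using P[OF i j] \<gamma> by (intro wnorm2_minus_dist_le) auto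
    then have "wnorm2 Q x + wnorm2 R u + wnorm2 (P i j) v
        - \<gamma>\<^sup>2 * ((norm (v - (1 / 2) *\<^sub>R (a i + a j)))\<^sup>2 + (norm ((1 / 2) *\<^sub>R (a i - a j)))\<^sup>2)
      \<le> wnorm2 (P j k) x"
      using ineq[OF i j k_mem ne, of x] unfolding s d Ru by (simp add: distrib_left)
    then have *: "wnorm2 Q x + wnorm2 R u + wnorm2 (P i j) v
        - \<gamma>\<^sup>2 * (((norm (a i - v))\<^sup>2 + (norm (a j - v))\<^sup>2) / 2) \<le> wnorm2 (P j k) x"
      unfolding mean_square_dist .
    have "\<gamma>\<^sup>2 / 2 * c k \<le> \<gamma>\<^sup>2 / 2 * c i"
      using k_min[OF i] by (intro mult_left_mono) auto
    then have "wnorm2 Q x + wnorm2 R u + ?F i j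
      \<le> wnorm2 (P j k) x - \<gamma>\<^sup>2 / 2 * c j - \<gamma>\<^sup>2 / 2 * c k"
      using * by (simp add: field_simps)
    also have "\<dots> \<le> model_value N \<gamma> P c x"
      by (rule model_value_ge[OF j k_mem])
    finally show ?thesis .
  qed
  have "model_value N \<gamma> P (\<lambda>i. c i + (norm (a i - v))\<^sup>2) v
    \<le> model_value N \<gamma> P c x - wnorm2 Q x - wnorm2 R u"
  proof (rule model_value_le[OF N])
    fix i j assume i: "i \<in> {1..N}" and j: "j \<in> {1..N}"
    have "P i j = P j i"
      using P[OF i j] by simp
    then have "?F i j = ?F j i"
      by simp
    \<comment> \<open>Both orders would be excluded only if \<open>j = k = i\<close>, against
      \<open>i \<noteq> j\<close>.\<close>
    moreover have "\<not> (i \<noteq> j \<and> j = k) \<or> \<not> (j \<noteq> i \<and> i = k)"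
      by auto
    ultimately have "wnorm2 Q x + wnorm2 R u + ?F i j \<le> model_value N \<gamma> P c x"
      using bound[OF i j] bound[OF j i] by metis
    then show "?F i j \<le> model_value N \<gamma> P c x - wnorm2 Q x - wnorm2 R u"
      by linarith
  qed
  then show ?thesis
    unfolding a_def by linarith
qed

section \<open>Bellman inequality and cost bound\<close>

theorem theorem3:
  fixes N :: nat
    and \<gamma> :: real
    and A :: "nat \<Rightarrow> real^'n^'n"
    and B :: "nat \<Rightarrow> real^'m^'n"
    and Q :: "real^'n^'n"
    and R :: "real^'m^'m"
    and K :: "nat \<Rightarrow> real^'n^'m"
    and P :: "nat \<Rightarrow> nat \<Rightarrow> real^'n^'n"
  assumes "N \<ge> 1"
    and "\<gamma> > 0"
    and "pos_def Q"
    and "pos_def R"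
    and "\<And>i j. i \<in> {1..N} \<Longrightarrow> j \<in> {1..N} \<Longrightarrow>
          pos_def (P i j) \<and> P i j = P j i \<and> pos_def (\<gamma>\<^sup>2 *\<^sub>R mat 1 - P i j)"
    and "\<And>x i j k. i \<in> {1..N} \<Longrightarrow> j \<in> {1..N} \<Longrightarrow> k \<in> {1..N} \<Longrightarrow> \<not> (i \<noteq> j \<and> j = k) \<Longrightarrow>
          wnorm2 (P j k) x \<ge>
            wnorm2 Q x + wnorm2 R (K k *v x)
            + wnorm2 (matrix_inv (matrix_inv (P i j) - (1 / \<gamma>\<^sup>2) *\<^sub>R mat 1))
                (((1 / 2) *\<^sub>R (A i - B i ** K k + A j - B j ** K k)) *v x)
            - \<gamma>\<^sup>2 * (norm (((1 / 2) *\<^sub>R (A i - B i ** K k - A j + B j ** K k)) *v x))\<^sup>2"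
  shows "(\<forall>x Z. pos_semidef Z \<longrightarrow>
            bellman Q R (\<lambda>y Y. ereal (Vbar N \<gamma> A B P y Y)) x Z \<le> ereal (Vbar N \<gamma> A B P x Z)) \<and>
         (\<forall>k. least_squares_selection N A B k \<longrightarrow>
            (\<forall>x0. cost ((\<lambda>i. (A i, B i)) ` {1..N}) \<gamma> Q R (selected_feedback K k) x0
                    \<le> ereal (MAX (i, j) \<in> {1..N} \<times> {1..N}. wnorm2 (P i j) x0)))"
proof -
  have step: "wnorm2 Q x + wnorm2 R (- (K k *v x))
      + model_value N \<gamma> P (\<lambda>i. c i + (norm (A i *v x + B i *v (- (K k *v x)) - v))\<^sup>2) v
    \<le> model_value N \<gamma> P c x"
    if "is_arg_min c (\<lambda>i. i \<in> {1..N}) k" for c k x v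
    by (rule model_value_step; fact assms that refl)
  show ?thesis
  proof (intro conjI allI impI)
    fix x :: "real^'n" and Z :: "real^('n + 'n + 'm)^('n + 'n + 'm)"
    define c where "c i = wfrob2 Z (transpose (block_row (A i) (B i)))" for i
    \<comment> \<open>The input \<open>- (K k *v x)\<close> for this \<open>k\<close> is the witness
      that bounds the infimum.\<close>
    obtain k where k: "is_arg_min c (\<lambda>i. i \<in> {1..N}) k"
      using ex_is_arg_min_if_finite[of "{1..N}" c] assms(1) by auto
    have "(SUP v. ereal (wnorm2 Q x + wnorm2 R (- (K k *v x)))
          + ereal (Vbar N \<gamma> A B P v (Z + outer (stack3 (- v) x (- (K k *v x))))))
        \<le> ereal (Vbar N \<gamma> A B P x Z)"
      unfolding Vbar_add_outer unfolding Vbar_eq_model_value c_def[symmetric]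
      using step[OF k] by (intro SUP_least) simp
    then show "bellman Q R (\<lambda>y Y. ereal (Vbar N \<gamma> A B P y Y)) x Z \<le> ereal (Vbar N \<gamma> A B P x Z)"
      unfolding bellman_def by (rule INF_lower2[OF UNIV_I])
  next
    fix k :: "nat \<Rightarrow> (real^'n) list \<Rightarrow> (real^'m) list \<Rightarrow> nat" and x0 :: "real^'n"
    assume k: "least_squares_selection N A B k"
    show "cost ((\<lambda>i. (A i, B i)) ` {1..N}) \<gamma> Q R (selected_feedback K k) x0
      \<le> ereal (MAX (i, j) \<in> {1..N} \<times> {1..N}. wnorm2 (P i j) x0)"
      unfolding cost_def
    proof (rule Sup_least, clarify, simp only: ereal_less_eq)
      fix h w x u i
      assume i: "i \<in> {1..N}" and "trajectory (A i) (B i) (selected_feedback K k) w x0 x u"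
      then have x_0: "x 0 = x0"
        and u: "u t = selected_feedback K k t (map x [0..<Suc t]) (map u [0..<t])"
        and x_Suc: "x (Suc t) = A i *v x t + B i *v u t + w t" for t
        unfolding trajectory_def by blast+
      define c where "c t j = (\<Sum>\<tau><t. (norm (A j *v x \<tau> + B j *v u \<tau> - x (Suc \<tau>)))\<^sup>2)" for t j
      \<comment> \<open>The disturbance penalty is left out here: it is carried by \<open>c\<close>
        and returns through \<open>c_true\<close>.\<close>
      define stage where "stage t = wnorm2 Q (x t) + wnorm2 R (u t)" for t
      have decrease: "stage t + model_value N \<gamma> P (c (Suc t)) (x (Suc t))
        \<le> model_value N \<gamma> P (c t) (x t)" for t
      proof -
        define xs where "xs = map x [0..<Suc t]"
        define us where "us = map u [0..<t]"
        have nth: "xs ! \<tau> = x \<tau>" if "\<tau> \<le> t" for \<tau>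
          using that by (simp add: xs_def less_Suc_eq_le del: upt_Suc)
        \<comment> \<open>The \<open>Suc t\<close> states known at time \<open>t\<close> contain
          every successor state that enters \<open>c t\<close>, so the selected index minimizes
          exactly \<open>c t\<close>.\<close>
        have "(\<lambda>j. \<Sum>\<tau><t. (norm (A j *v (xs ! \<tau>) + B j *v (us ! \<tau>) - xs ! Suc \<tau>))\<^sup>2) = c t"
          by (rule ext, unfold c_def, rule sum.cong) (auto simp: nth us_def)
        moreover have "length xs = Suc t" "length us = t"
          by (simp_all add: xs_def us_def)
        ultimately have "is_arg_min (c t) (\<lambda>j. j \<in> {1..N}) (k t xs us)"
          using k[unfolded least_squares_selection_def, rule_format, of xs t us] by simp
        moreover have "u t = - (K (k t xs us) *v x t)"
          using u[of t]
          unfolding selected_feedback_def xs_def[symmetric] us_def[symmetric] nth[OF order_refl] .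
        moreover have "c (Suc t) = (\<lambda>j. c t j + (norm (A j *v x t + B j *v u t - x (Suc t)))\<^sup>2)"
          by (simp add: fun_eq_iff c_def)
        ultimately show ?thesis
          using step[of "c t" "k t xs us" "x t" "x (Suc t)"] unfolding stage_def by (simp only:)
      qed
      have telescope: "(\<Sum>t<n. stage t) + model_value N \<gamma> P (c n) (x n) \<le> model_value N \<gamma> P (c 0) (x 0)"
        for n
      proof (induction n)
        case (Suc n)
        then show ?case
          using decrease[of n] by simp
      qed simp
      have c_true: "c n i = (\<Sum>t<n. (norm (w t))\<^sup>2)" for n
        unfolding c_def by (simp add: x_Suc)
      have P_nonneg: "wnorm2 (P i i) y \<ge> 0" for y
        using assms(5)[OF i i] by (cases "y = 0") (auto simp: pos_def_def wnorm2_def less_imp_le)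
      \<comment> \<open>On the diagonal pair of the true model, the two halves of \<gamma> squared
        add up to the full penalty.\<close>
      have "- (\<gamma>\<^sup>2 * c n i) \<le> model_value N \<gamma> P (c n) (x n)" for n
        using model_value_ge[OF i i, of P "x n" \<gamma> "c n"] P_nonneg[of "x n"] by linarith
      \<comment> \<open>The cost sum includes \<open>t = h\<close>, hence \<open>Suc h\<close>
        steps; the last one accounts for \<open>w h\<close>.\<close>
      from this[of "Suc h"] telescope[of "Suc h"]
      have "(\<Sum>t\<le>h. stage t) - \<gamma>\<^sup>2 * (\<Sum>t\<le>h. (norm (w t))\<^sup>2) \<le> model_value N \<gamma> P (c 0) (x 0)"
        unfolding c_true lessThan_Suc_atMost by linarith
      then have "(\<Sum>t\<le>h. stage t - \<gamma>\<^sup>2 * (norm (w t))\<^sup>2) \<le> model_value N \<gamma> P (c 0) (x 0)"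
        by (simp add: sum_subtractf sum_distrib_left)
      \<comment> \<open>At time 0 the errors are empty sums, so only the quadratic forms
        remain.\<close>
      also have "\<dots> = (MAX (i, j) \<in> {1..N} \<times> {1..N}. wnorm2 (P i j) x0)"
        by (simp add: model_value_def c_def x_0)
      finally show "(\<Sum>t\<le>h. wnorm2 Q (x t) + wnorm2 R (u t) - \<gamma>\<^sup>2 * (norm (w t))\<^sup>2)
        \<le> (MAX (i, j) \<in> {1..N} \<times> {1..N}. wnorm2 (P i j) x0)"
        unfolding stage_def .
    qed
  qed
qed

end
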